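(* Let $k\ge 2$. The spectrum of the commuting graph of the projective special linear group $PSL(2,2^k)$ (over the field with $2^k$ elements) is $$\left\{(-1)^{2^{3k}-2^{2k}-2^{k+1}-2},\ (2^k-1)^{2^{k-1}(2^k-1)},\ (2^k-2)^{2^k+1},\ (2^k-3)^{2^{k-1}(2^k+1)}\right\}.$$
   Context: For a finite non-abelian group $G$ with centre $Z(G)$, the commuting graph $\Gamma_G$ is the simple undirected graph with vertex set $G\setminus Z(G)$ in which two distinct vertices $x,y$ are adjacent if and only if $xy=yx$. The spectrum of a graph is the multiset of eigenvalues of its adjacency matrix, written $\{\lambda_1^{k_1},\dots,\lambda_r^{k_r}\}$, where $\lambda^{m}$ denotes that $\lambda$ is listed $m$ times (listed values may coincide, in which case multiplicities add). *)

theory Defs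
  imports
    "HOL-Algebra.Coset"
    "HOL-Library.Cardinality"
    "HOL-Library.Multiset"
    "HOL-Computational_Algebra.Fundamental_Theorem_Algebra"
    "Graph_Theory.Pair_Digraph"
    "Jordan_Normal_Form.Char_Poly"
begin

definition group_center :: "('g, 'm) monoid_scheme \<Rightarrow> 'g set" where
  "group_center G = {z \<in> carrier G. \<forall>x \<in> carrier G. z \<otimes>\<^bsub>G\<^esub> x = x \<otimes>\<^bsub>G\<^esub> z}"

text \<open>
  A simple undirected graph is represented, as usual in the library of digraphs, by the
  symmetric loop-free set of ordered pairs of adjacent vertices.
\<close>

definition commuting_graph :: "('g, 'm) monoid_scheme \<Rightarrow> 'g pair_pre_digraph" where
  "commuting_graph G =
     \<lparr> pverts = carrier G - group_center G,
       parcs = {(x, y). x \<in> carrier G - group_center G \<and> y \<in> carrier G - group_center G \<and>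
                        x \<noteq> y \<and> x \<otimes>\<^bsub>G\<^esub> y = y \<otimes>\<^bsub>G\<^esub> x} \<rparr>"

text \<open>The adjacency matrix with respect to an enumeration of the vertices.\<close>

definition adjacency_matrix :: "'v pair_pre_digraph \<Rightarrow> 'v list \<Rightarrow> complex mat" where
  "adjacency_matrix \<Gamma> vs =
     mat (length vs) (length vs) (\<lambda>(i, j). if (vs ! i, vs ! j) \<in> parcs \<Gamma> then 1 else 0)"

text \<open>
  The eigenvalues are counted with their algebraic multiplicity over the complex numbers, so that
  the spectrum always has as many elements as the graph has vertices.  The enumeration chosen
  here is irrelevant, see \<open>graph_spectrum_eq\<close> below.
\<close>

definition graph_spectrum :: "'v pair_pre_digraph \<Rightarrow> complex multiset" where
  "graph_spectrum \<Gamma> =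
     proots (char_poly (adjacency_matrix \<Gamma> (SOME vs. distinct vs \<and> set vs = pverts \<Gamma>)))"

definition SL :: "nat \<Rightarrow> 'a :: field mat monoid" where
  "SL n = \<lparr> carrier = {A \<in> carrier_mat n n. det A = 1}, monoid.mult = (*), one = 1\<^sub>m n \<rparr>"

definition PSL :: "nat \<Rightarrow> 'a :: field mat set monoid" where
  "PSL n = SL n Mod group_center (SL n)"


subsection \<open>Well-definedness\<close>

lemma pair_graph_commuting_graph:
  assumes "finite (carrier G)"
  shows "pair_graph (commuting_graph G)"
proof
  show "finite (pverts (commuting_graph G))"
    using assms by (simp add: commuting_graph_def)
  have "parcs (commuting_graph G) \<subseteq> carrier G \<times> carrier G"
    by (auto simp: commuting_graph_def)
  then show "finite (parcs (commuting_graph G))"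
    using assms by (meson finite_SigmaI finite_subset)
  show "symmetric (with_proj (commuting_graph G))"
    by (auto simp: symmetric_def sym_def commuting_graph_def)
qed (auto simp: commuting_graph_def)

lemma char_poly_adjacency_matrix_cong:
  assumes "distinct vs" "distinct ws" "set vs = set ws"
  shows "char_poly (adjacency_matrix \<Gamma> vs) = char_poly (adjacency_matrix \<Gamma> ws)"
proof -
  define n where "n = length vs"
  have ln: "length vs = n" "length ws = n"
    using assms by (auto simp: n_def) (metis distinct_card)
  define P :: "complex mat" where "P = mat n n (\<lambda>(i, j). if vs ! i = ws ! j then 1 else 0)"
  define Q :: "complex mat" where "Q = mat n n (\<lambda>(i, j). if ws ! i = vs ! j then 1 else 0)"
  have ex_ws: "\<exists>j<n. ws ! j = vs ! i" if "i < n" for i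
    using that assms ln by (metis in_set_conv_nth)
  have ex_vs: "\<exists>j<n. vs ! j = ws ! i" if "i < n" for i
    using that assms ln by (metis in_set_conv_nth)
  define f where "f i = (SOME j. j < n \<and> ws ! j = vs ! i)" for i
  have f: "f i < n" "ws ! (f i) = vs ! i" if "i < n" for i
    using someI_ex[of "\<lambda>j. j < n \<and> ws ! j = vs ! i"] ex_ws[OF that] by (auto simp: f_def)
  have f_iff: "vs ! i = ws ! j \<longleftrightarrow> j = f i" if "i < n" "j < n" for i j
    using f[OF that(1)] that assms ln by (metis nth_eq_iff_index_eq)
  have f_iff': "ws ! j = vs ! i \<longleftrightarrow> j = f i" if "i < n" "j < n" for i j
    using f_iff[OF that] by metis
  have f_inj: "f i = f j \<longleftrightarrow> i = j" if "i < n" "j < n" for i j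
    using f that assms ln by (metis nth_eq_iff_index_eq)
  have PX: "P * X = mat n n (\<lambda>(i, j). X $$ (f i, j))" if "X \<in> carrier_mat n n" for X
  proof (rule eq_matI)
    fix i j assume "i < dim_row (mat n n (\<lambda>(i, j). X $$ (f i, j)))"
      "j < dim_col (mat n n (\<lambda>(i, j). X $$ (f i, j)))"
    then have ij: "i < n" "j < n" by auto
    have "(P * X) $$ (i, j) = (\<Sum>l\<in>{0..<n}. (if vs ! i = ws ! l then 1 else 0) * X $$ (l, j))"
      using ij that by (simp add: P_def scalar_prod_def)
    also have "\<dots> = (\<Sum>l\<in>{0..<n}. if l = f i then X $$ (l, j) else 0)"
      using ij f_iff by (intro sum.cong) auto
    also have "\<dots> = X $$ (f i, j)"
      using f[OF ij(1)] by simp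
    finally show "(P * X) $$ (i, j) = mat n n (\<lambda>(i, j). X $$ (f i, j)) $$ (i, j)"
      using ij by simp
  qed (use that in \<open>auto simp: P_def\<close>)
  have XQ: "X * Q = mat n n (\<lambda>(i, j). X $$ (i, f j))" if "X \<in> carrier_mat n n" for X
  proof (rule eq_matI)
    fix i j assume "i < dim_row (mat n n (\<lambda>(i, j). X $$ (i, f j)))"
      "j < dim_col (mat n n (\<lambda>(i, j). X $$ (i, f j)))"
    then have ij: "i < n" "j < n" by auto
    have "(X * Q) $$ (i, j) = (\<Sum>l\<in>{0..<n}. X $$ (i, l) * (if ws ! l = vs ! j then 1 else 0))"
      using ij that by (simp add: Q_def scalar_prod_def)
    also have "\<dots> = (\<Sum>l\<in>{0..<n}. if l = f j then X $$ (i, l) else 0)"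
      using ij f_iff' by (intro sum.cong) auto
    also have "\<dots> = X $$ (i, f j)"
      using f[OF ij(2)] by simp
    finally show "(X * Q) $$ (i, j) = mat n n (\<lambda>(i, j). X $$ (i, f j)) $$ (i, j)"
      using ij by simp
  qed (use that in \<open>auto simp: Q_def\<close>)
  have carr: "P \<in> carrier_mat n n" "Q \<in> carrier_mat n n"
    "adjacency_matrix \<Gamma> vs \<in> carrier_mat n n" "adjacency_matrix \<Gamma> ws \<in> carrier_mat n n"
    by (simp_all add: P_def Q_def adjacency_matrix_def ln)
  have PQ: "P * Q = 1\<^sub>m n"
    unfolding PX[OF carr(2)] by (rule eq_matI) (use assms(1) ln in \<open>auto simp: Q_def f nth_eq_iff_index_eq\<close>)
  have QP: "Q * P = 1\<^sub>m n"
    by (rule mat_mult_left_right_inverse[OF carr(1,2) PQ])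
  have "P * adjacency_matrix \<Gamma> ws * Q = mat n n (\<lambda>(i, j). adjacency_matrix \<Gamma> ws $$ (f i, f j))"
    unfolding PX[OF carr(4)] by (subst XQ) (auto simp: f)
  also have "\<dots> = adjacency_matrix \<Gamma> vs"
    by (rule eq_matI) (auto simp: adjacency_matrix_def ln f)
  finally have "similar_mat (adjacency_matrix \<Gamma> vs) (adjacency_matrix \<Gamma> ws)"
    by (intro similar_matI[OF _ PQ QP]) (use carr in simp_all)
  then show ?thesis
    by (rule char_poly_similar)
qed

lemma graph_spectrum_eq:
  assumes "distinct vs" "set vs = pverts \<Gamma>"
  shows "graph_spectrum \<Gamma> = proots (char_poly (adjacency_matrix \<Gamma> vs))"
proof -
  have "\<exists>vs. distinct vs \<and> set vs = pverts \<Gamma>"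
    using assms by blast
  from someI_ex[OF this] show ?thesis
    using char_poly_adjacency_matrix_cong[of "SOME vs. distinct vs \<and> set vs = pverts \<Gamma>" vs \<Gamma>] assms
    by (simp add: graph_spectrum_def)
qed

lemma size_graph_spectrum:
  assumes "finite (pverts \<Gamma>)"
  shows "size (graph_spectrum \<Gamma>) = card (pverts \<Gamma>)"
proof -
  obtain vs where vs: "distinct vs" "set vs = pverts \<Gamma>"
    using finite_distinct_list[OF assms] by blast
  have "adjacency_matrix \<Gamma> vs \<in> carrier_mat (length vs) (length vs)"
    by (simp add: adjacency_matrix_def)
  from degree_monic_char_poly[OF this] show ?thesis
    by (simp add: graph_spectrum_eq[OF vs] size_proots_complex distinct_card[OF vs(1), symmetric] vs(2))
qed

lemma normal_group_center:
  fixes G (structure)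
  assumes "group G"
  shows "group_center G \<lhd> G"
proof -
  interpret group G by fact
  have inv: "inv z \<in> group_center G" if z: "z \<in> group_center G" for z
  proof -
    have zc: "z \<in> carrier G" using z by (simp add: group_center_def)
    have "inv z \<otimes> x = x \<otimes> inv z" if x: "x \<in> carrier G" for x
    proof -
      have "z \<otimes> x = x \<otimes> z" using z x by (simp add: group_center_def)
      have "inv z \<otimes> x = inv z \<otimes> (x \<otimes> z) \<otimes> inv z"
        using zc x by (simp add: m_assoc)
      also have "\<dots> = inv z \<otimes> (z \<otimes> x) \<otimes> inv z"
        using \<open>z \<otimes> x = x \<otimes> z\<close> by simp
      also have "\<dots> = x \<otimes> inv z"
        using zc x by (simp flip: m_assoc)
      finally show ?thesis .
    qed
    then show ?thesis using zc by (simp add: group_center_def)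
  qed
  have "subgroup (group_center G) G"
  proof
    fix x y assume xy: "x \<in> group_center G" "y \<in> group_center G"
    then have c: "x \<in> carrier G" "y \<in> carrier G" by (auto simp: group_center_def)
    have "x \<otimes> y \<otimes> w = w \<otimes> (x \<otimes> y)" if w: "w \<in> carrier G" for w
    proof -
      have "x \<otimes> w = w \<otimes> x" "y \<otimes> w = w \<otimes> y"
        using xy w by (auto simp: group_center_def)
      then show ?thesis using c w by (metis m_assoc)
    qed
    then show "x \<otimes> y \<in> group_center G" using c by (simp add: group_center_def)
  qed (use inv in \<open>auto simp: group_center_def\<close>)
  then show ?thesis
    by (rule normalI) (auto simp: r_coset_def l_coset_def group_center_def)
qed

lemma group_SL: "group (SL n :: 'a :: field mat monoid)"
proof (rule groupI)
  fix A :: "'a mat" assume "A \<in> carrier (SL n)"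
  then have A: "A \<in> carrier_mat n n" "det A = 1" by (auto simp: SL_def)
  from adj_mat[OF A(1)] A(2) have B: "adj_mat A \<in> carrier_mat n n" "adj_mat A * A = 1\<^sub>m n"
    by auto
  have "det (adj_mat A) = 1"
    using det_mult[OF B(1) A(1)] B(2) A(2) by simp
  with B show "\<exists>B\<in>carrier (SL n). B \<otimes>\<^bsub>SL n\<^esub> A = \<one>\<^bsub>SL n\<^esub>"
    by (auto simp: SL_def)
qed (auto simp: SL_def det_mult[where n = n] assoc_mult_mat[of _ n n _ n _ n])

lemma group_PSL: "group (PSL n :: 'a :: field mat set monoid)"
  unfolding PSL_def by (rule normal.factorgroup_is_group[OF normal_group_center[OF group_SL]])

lemma finite_SL: "finite (carrier (SL n :: 'a :: {field, finite} mat monoid))"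
proof -
  have "carrier (SL n :: 'a mat monoid) \<subseteq>
          (\<lambda>f. mat n n f) ` (({..<n} \<times> {..<n}) \<rightarrow>\<^sub>E (UNIV :: 'a set))" (is "_ \<subseteq> ?R")
  proof
    fix A :: "'a mat" assume "A \<in> carrier (SL n)"
    then have "A = mat n n (restrict (\<lambda>ij. A $$ ij) ({..<n} \<times> {..<n}))"
      by (intro eq_matI) (auto simp: SL_def)
    moreover have "restrict (\<lambda>ij. A $$ ij) ({..<n} \<times> {..<n}) \<in> ({..<n} \<times> {..<n}) \<rightarrow>\<^sub>E UNIV"
      by simp
    ultimately show "A \<in> ?R" by (rule image_eqI)
  qed
  then show ?thesis
    by (rule finite_subset) (simp add: finite_PiE)
qed

lemma finite_PSL: "finite (carrier (PSL n :: 'a :: {field, finite} mat set monoid))"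
  by (simp add: PSL_def FactGroup_def RCOSETS_def finite_SL)

end

theory Submission
  imports Defs "HOL-Number_Theory.Residues"
begin

text \<open>
  In characteristic 2 the group \<open>SL(2,q)\<close> has trivial centre, so it can replace \<open>PSL(2,q)\<close>.  Two
  nonscalar matrices \<open>(a b; c d)\<close> commute iff their vectors \<open>(a - d, b, c)\<close> are proportional.  Hence commuting is an equivalence relation on the noncentral elements, the classes
  are indexed by the points of the projective plane, and the commuting graph is a disjoint union of
  cliques.  A clique with \<open>n\<close> vertices contributes the eigenvalue \<open>n - 1\<close> once and \<open>-1\<close> with
  multiplicity \<open>n - 1\<close>.

  Since every element is a square, exactly one scalar multiple of an invertible matrix has
  determinant 1.  So the class of the point \<open>(t : b : c)\<close>, represented by
  \<open>N = (t b; c 0)\<close>, is in bijection with the \<open>z\<close> such that \<open>det (z I + N) = z^2 + t z - b c\<close> does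
  not vanish, and it has \<open>q - 1\<close> elements if \<open>t = 0\<close>, and \<open>q - 2\<close> or \<open>q\<close> elements if \<open>t = 1\<close>
  depending on whether this polynomial splits.  Counting the triples \<open>(b, c, z)\<close> with
  \<open>z (z + 1) = b c\<close> in two ways shows that it splits for \<open>q (q + 1) / 2\<close> of the pairs \<open>(b, c)\<close>.
\<close>

subsection \<open>Disjoint unions of cliques\<close>

text \<open>The matrix sends the all-ones vector \<open>e\<close> to \<open>n - 1\<close> times
  itself and any other unit vector \<open>e_j\<close> to \<open>e - e_j\<close>. In the basis of
  \<open>e\<close> and the unit vectors after the first it becomes the upper triangular
  \<open>B\<close>, whose diagonal shows the eigenvalues.\<close>

lemma char_poly_complete_graph:
  assumes "n > 0"
  shows "char_poly (mat n n (\<lambda>(i, j). if i = j then 0 else 1) :: complex mat) =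
           [:- of_nat (n - 1), 1:] * [:1, 1:] ^ (n - 1)"
proof -
  define A :: "complex mat" where "A = mat n n (\<lambda>(i, j). if i = j then 0 else 1)"
  define B :: "complex mat" where
    "B = mat n n (\<lambda>(i, j). if i = 0 then (if j = 0 then of_nat (n - 1) else 1)
                         else if i = j then - 1 else 0)"
  \<comment> \<open>Change to the basis in which the first unit vector is replaced by the all-ones vector, an
    eigenvector of \<open>A\<close>.\<close>
  define P :: "complex mat" where "P = mat n n (\<lambda>(i, j). if j = 0 \<or> i = j then 1 else 0)"
  define Q :: "complex mat" where
    "Q = mat n n (\<lambda>(i, j). if i = j then 1 else if j = 0 then - 1 else 0)"
  have carr: "A \<in> carrier_mat n n" "B \<in> carrier_mat n n" "P \<in> carrier_mat n n" "Q \<in> carrier_mat n n"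
    by (simp_all add: A_def B_def P_def Q_def)
  have PX: "P * X = mat n n (\<lambda>(i, j). X $$ (0, j) + (if i = 0 then 0 else X $$ (i, j)))"
    if X: "X \<in> carrier_mat n n" for X
  proof (rule eq_matI)
    fix i j
    assume "i < dim_row (mat n n (\<lambda>(i, j). X $$ (0, j) + (if i = 0 then 0 else X $$ (i, j))))"
      "j < dim_col (mat n n (\<lambda>(i, j). X $$ (0, j) + (if i = 0 then 0 else X $$ (i, j))))"
    then have ij: "i < n" "j < n" by auto
    have "(P * X) $$ (i, j) = (\<Sum>l\<in>{0..<n}. (if l = 0 \<or> i = l then 1 else 0) * X $$ (l, j))"
      using ij X by (simp add: P_def scalar_prod_def)
    also have "\<dots> = (\<Sum>l\<in>{0..<n}. (if l = 0 then X $$ (l, j) else 0)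
                    + (if l = i then if i = 0 then 0 else X $$ (l, j) else 0))"
      by (intro sum.cong) auto
    also have "\<dots> = X $$ (0, j) + (if i = 0 then 0 else X $$ (i, j))"
      using ij by (simp add: sum.distrib)
    finally show "(P * X) $$ (i, j) =
        mat n n (\<lambda>(i, j). X $$ (0, j) + (if i = 0 then 0 else X $$ (i, j))) $$ (i, j)"
      using ij by simp
  qed (use X carr in auto)
  have PQ: "P * Q = 1\<^sub>m n"
    unfolding PX[OF carr(4)] by (rule eq_matI) (auto simp: Q_def)
  have QP: "Q * P = 1\<^sub>m n"
    by (rule mat_mult_left_right_inverse[OF carr(3,4) PQ])
  have "P * B = A * P"
  proof (rule eq_matI)
    fix i j assume "i < dim_row (A * P)" "j < dim_col (A * P)"
    then have ij: "i < n" "j < n" using carr by auto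
    have "(A * P) $$ (i, j) =
        (\<Sum>l\<in>{0..<n}. (if i = l then 0 else 1) * (if j = 0 \<or> l = j then 1 else 0))"
      using ij by (simp add: A_def P_def scalar_prod_def)
    also have "\<dots> = (if j = 0 then of_nat (n - 1) else if i = j then 0 else 1)"
    proof (cases "j = 0")
      case True
      have "(\<Sum>l\<in>{0..<n}. if i = l then 0 else 1 :: complex) = (\<Sum>l\<in>{0..<n} - {i}. 1)"
        by (rule sum.mono_neutral_cong_right) auto
      then show ?thesis using True ij by (simp add: card_Diff_singleton)
    next
      case False
      have "(\<Sum>l\<in>{0..<n}. (if i = l then 0 else 1) * (if j = 0 \<or> l = j then 1 else 0 :: complex))
          = (\<Sum>l\<in>{0..<n}. if l = j then if i = j then 0 else 1 else 0)"
        using False by (intro sum.cong) auto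
      also have "\<dots> = (if i = j then 0 else 1)"
        using ij by (subst sum.delta) auto
      finally show ?thesis using False by simp
    qed
    also have "\<dots> = (P * B) $$ (i, j)"
      unfolding PX[OF carr(2)] using ij by (auto simp: B_def)
    finally show "(P * B) $$ (i, j) = (A * P) $$ (i, j)" by simp
  qed (use carr in auto)
  then have "P * B * Q = A * (P * Q)"
    using carr by (simp add: assoc_mult_mat[of _ n n _ n _ n])
  then have "A = P * B * Q"
    using carr by (simp add: PQ)
  then have "similar_mat A B"
    by (intro similar_matI[OF _ PQ QP]) (use carr in simp_all)
  then have "char_poly A = char_poly B"
    by (rule char_poly_similar)
  also have "\<dots> = (\<Prod>a\<leftarrow>diag_mat B. [:- a, 1:])"
    by (rule char_poly_upper_triangular[OF carr(2)]) (auto simp: B_def)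
  also have "diag_mat B = of_nat (n - 1) # replicate (n - 1) (- 1)"
    using assms by (intro nth_equalityI) (auto simp: diag_mat_def B_def nth_Cons')
  finally show ?thesis by (simp add: A_def prod_list_replicate)
qed

lemma char_poly_four_block_diag:
  assumes "A \<in> carrier_mat n n" "B \<in> carrier_mat m m"
  shows "char_poly (four_block_mat A (0\<^sub>m n m) (0\<^sub>m m n) B :: 'a :: idom mat) =
           char_poly A * char_poly B"
proof -
  have "char_poly_matrix (four_block_mat A (0\<^sub>m n m) (0\<^sub>m m n) B) =
          four_block_mat (char_poly_matrix A) (0\<^sub>m n m) (0\<^sub>m m n) (char_poly_matrix B)"
    by (rule eq_matI) (use assms in \<open>auto simp: char_poly_matrix_def\<close>)
  then show ?thesis
    unfolding char_poly_def
    by (simp add: det_four_block_mat_lower_left_zero[OF char_poly_matrix_closed _ refl char_poly_matrix_closed] assms)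
qed

text \<open>Induction on the set of cliques, each step splitting off one diagonal block. The list
  \<open>vs\<close> is arbitrary because the remaining cliques get an enumeration of their
  own.\<close>

lemma char_poly_adjacency_matrix_disjoint_cliques:
  assumes "finite I" "disjoint_family_on C I" "\<And>i. i \<in> I \<Longrightarrow> finite (C i) \<and> C i \<noteq> {}"
    and "\<And>i j x y. i \<in> I \<Longrightarrow> j \<in> I \<Longrightarrow> x \<in> C i \<Longrightarrow> y \<in> C j \<Longrightarrow>
           (x, y) \<in> parcs \<Gamma> \<longleftrightarrow> i = j \<and> x \<noteq> y"
    and "distinct vs" "set vs = (\<Union>i\<in>I. C i)"
  shows "char_poly (adjacency_matrix \<Gamma> vs) =
           (\<Prod>i\<in>I. [:- of_nat (card (C i) - 1), 1:] * [:1, 1:] ^ (card (C i) - 1))"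
  using assms
proof (induction I arbitrary: vs)
  case empty
  then have "char_poly (adjacency_matrix \<Gamma> vs) = 1"
    by (simp add: char_poly_def adjacency_matrix_def char_poly_matrix_def det_def)
  then show ?case by simp
next
  case (insert i I)
  have disj: "C i \<inter> (\<Union>j\<in>I. C j) = {}" "disjoint_family_on C I"
    using insert.prems(1) insert.hyps(2) by (simp_all add: disjoint_family_on_insert)
  obtain us where us: "distinct us" "set us = C i"
    using insert.prems(2) finite_distinct_list[of "C i"] by auto
  obtain ws where ws: "distinct ws" "set ws = (\<Union>j\<in>I. C j)"
    using insert.prems(2) insert.hyps(1) finite_distinct_list[of "\<Union>j\<in>I. C j"] by auto
  have len: "length us = card (C i)" "length us > 0"
    using us insert.prems(2)[of i] by (auto simp flip: distinct_card)
  have uu: "(x, y) \<in> parcs \<Gamma> \<longleftrightarrow> x \<noteq> y" if "x \<in> set us" "y \<in> set us" for x y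
    using that us insert.prems(3)[of i i] by auto
  have uw: "(x, y) \<notin> parcs \<Gamma>" "(y, x) \<notin> parcs \<Gamma>" if x: "x \<in> set us" and y: "y \<in> set ws" for x y
  proof -
    obtain j where "j \<in> I" "y \<in> C j" using y ws by auto
    then show "(x, y) \<notin> parcs \<Gamma>" "(y, x) \<notin> parcs \<Gamma>"
      using x us insert.hyps(2) insert.prems(3)[of i j x y] insert.prems(3)[of j i y x] by auto
  qed
  \<comment> \<open>Reordering the vertices keeps the characteristic polynomial, so the new clique
    may be listed first. No arc leaves it, hence the off-diagonal blocks vanish.\<close>
  have "char_poly (adjacency_matrix \<Gamma> vs) = char_poly (adjacency_matrix \<Gamma> (us @ ws))"
    using us ws disj insert.prems(4,5) by (intro char_poly_adjacency_matrix_cong) auto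
  also have "adjacency_matrix \<Gamma> (us @ ws) =
      four_block_mat (adjacency_matrix \<Gamma> us) (0\<^sub>m (length us) (length ws))
        (0\<^sub>m (length ws) (length us)) (adjacency_matrix \<Gamma> ws)"
    by (rule eq_matI) (auto simp: adjacency_matrix_def nth_append uw)
  also have "char_poly \<dots> = char_poly (adjacency_matrix \<Gamma> us) * char_poly (adjacency_matrix \<Gamma> ws)"
    by (rule char_poly_four_block_diag) (auto simp: adjacency_matrix_def)
  also have "adjacency_matrix \<Gamma> us = mat (length us) (length us) (\<lambda>(i, j). if i = j then 0 else 1)"
    by (rule eq_matI) (use us in \<open>auto simp: adjacency_matrix_def uu nth_eq_iff_index_eq\<close>)
  also have "char_poly \<dots> = [:- of_nat (card (C i) - 1), 1:] * [:1, 1:] ^ (card (C i) - 1)"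
    using char_poly_complete_graph[OF len(2)] len(1) by simp
  also have "char_poly (adjacency_matrix \<Gamma> ws) =
      (\<Prod>i\<in>I. [:- of_nat (card (C i) - 1), 1:] * [:1, 1:] ^ (card (C i) - 1))"
    using insert.prems(2,3) disj ws by (intro insert.IH) auto
  finally show ?case
    by (simp only: prod.insert[OF insert.hyps])
qed

lemma graph_spectrum_disjoint_cliques:
  assumes "finite I" "disjoint_family_on C I" "\<And>i. i \<in> I \<Longrightarrow> finite (C i) \<and> C i \<noteq> {}"
    and "\<And>i j x y. i \<in> I \<Longrightarrow> j \<in> I \<Longrightarrow> x \<in> C i \<Longrightarrow> y \<in> C j \<Longrightarrow>
           (x, y) \<in> parcs \<Gamma> \<longleftrightarrow> i = j \<and> x \<noteq> y"
    and "pverts \<Gamma> = (\<Union>i\<in>I. C i)"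
  shows "graph_spectrum \<Gamma> =
    (\<Sum>i\<in>I. add_mset (of_nat (card (C i) - 1)) (replicate_mset (card (C i) - 1) (- 1)))"
proof -
  have "finite (pverts \<Gamma>)" using assms by simp
  then obtain vs where vs: "distinct vs" "set vs = pverts \<Gamma>"
    using finite_distinct_list by blast
  have "graph_spectrum \<Gamma> = proots (char_poly (adjacency_matrix \<Gamma> vs))"
    by (rule graph_spectrum_eq[OF vs])
  also have "char_poly (adjacency_matrix \<Gamma> vs) =
      (\<Prod>i\<in>I. [:- of_nat (card (C i) - 1), 1:] * [:1, 1:] ^ (card (C i) - 1))"
    using vs(2) assms(5)
    by (intro char_poly_adjacency_matrix_disjoint_cliques[OF assms(1-4) vs(1)]) auto
  also have "proots \<dots> = (\<Sum>i\<in>I. proots ([:- of_nat (card (C i) - 1), 1:] * [:1, 1:] ^ (card (C i) - 1)))"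
    by (rule proots_prod) (simp only: no_zero_divisors power_not_zero pCons_eq_0_iff one_neq_zero simp_thms)
  also have "\<dots> = (\<Sum>i\<in>I. add_mset (of_nat (card (C i) - 1)) (replicate_mset (card (C i) - 1) (- 1)))"
  proof (intro sum.cong refl)
    fix i
    have "[:- of_nat (card (C i) - 1), 1:] \<noteq> (0 :: complex poly)"
      "[:1, 1:] ^ (card (C i) - 1) \<noteq> (0 :: complex poly)" by simp_all
    from proots_mult[OF this] show "proots ([:- of_nat (card (C i) - 1), 1:] * [:1, 1:] ^ (card (C i) - 1)) =
        add_mset (of_nat (card (C i) - 1)) (replicate_mset (card (C i) - 1) (- 1 :: complex))"
      by (simp only:) (simp add: proots_power)
  qed
  finally show ?thesis .
qed


subsection \<open>Centralisers in \<open>SL(2,q)\<close>\<close>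

lemma two_eq_0_of_card_power_2:
  assumes "CARD('q :: {field, finite}) = 2 ^ k"
  shows "(2 :: 'q) = 0"
proof -
  have "prime CHAR('q)"
    by (intro prime_CHAR_semidom finite_imp_CHAR_pos) simp
  moreover have "CHAR('q) dvd 2 ^ k"
    using CHAR_dvd_CARD[where 'a = 'q] assms by simp
  ultimately have "CHAR('q) = 2"
    by (metis prime_dvd_power primes_dvd_imp_eq two_is_prime_nat)
  then show ?thesis
    using of_nat_CHAR[where 'a = 'q] by simp
qed

context
  assumes two: "(2 :: 'q :: {field, finite}) = 0"
begin

lemma uminus_eq_self_char_2: "- x = (x :: 'q)"
proof -
  have "x + x = 2 * x" by simp
  then show ?thesis using two by (simp add: eq_neg_iff_add_eq_0 neg_eq_iff_add_eq_0)
qed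

lemma diff_eq_add_char_2: "x - y = x + (y :: 'q)"
  using uminus_eq_self_char_2[of y] by (simp only: diff_conv_add_uminus)

lemma power2_eq_iff_char_2: "x ^ 2 = y ^ 2 \<longleftrightarrow> x = (y :: 'q)"
  using uminus_eq_self_char_2[of y] by (auto simp: power2_eq_iff)

text \<open>Squaring is injective in characteristic 2, hence surjective on a finite field.\<close>

lemma ex_square_root: "\<exists>x :: 'q. x ^ 2 = u"
proof -
  have "inj (\<lambda>x :: 'q. x ^ 2)" by (rule injI) (simp add: power2_eq_iff_char_2)
  then have "surj (\<lambda>x :: 'q. x ^ 2)" by (rule finite_UNIV_inj_surj[OF finite_class.finite_UNIV])
  then show ?thesis by (metis surjD)
qed

end

section \<open>Coordinates for 2 by 2 matrices\<close>

definition mat2 :: "'a \<Rightarrow> 'a \<Rightarrow> 'a \<Rightarrow> 'a \<Rightarrow> 'a mat" where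
  "mat2 a b c d = mat 2 2 (\<lambda>(i, j). if i = 0 then if j = 0 then a else b else if j = 0 then c else d)"

lemma mat2_carrier [simp]: "mat2 a b c d \<in> carrier_mat 2 2"
  by (simp add: mat2_def)

lemma mat2_eq_iff [simp]: "mat2 a b c d = mat2 a' b' c' d' \<longleftrightarrow> a = a' \<and> b = b' \<and> c = c' \<and> d = d'"
proof
  assume eq: "mat2 a b c d = mat2 a' b' c' d'"
  have "mat2 a b c d $$ (i, j) = mat2 a' b' c' d' $$ (i, j)" for i j by (simp add: eq)
  from this[of 0 0] this[of 0 1] this[of 1 0] this[of 1 1]
  show "a = a' \<and> b = b' \<and> c = c' \<and> d = d'" by (simp add: mat2_def)
qed simp

lemma carrier_mat_2_eq: "carrier_mat 2 2 = {mat2 a b c d | a b c d. True}"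
proof (intro equalityI subsetI)
  fix A :: "'a mat" assume "A \<in> carrier_mat 2 2"
  then have "A = mat2 (A $$ (0, 0)) (A $$ (0, 1)) (A $$ (1, 0)) (A $$ (1, 1))"
    by (intro eq_matI) (auto simp: mat2_def less_2_cases_iff)
  then show "A \<in> {mat2 a b c d | a b c d. True}" by blast
qed auto

lemma mat2_mult:
  "mat2 a b c d * mat2 a' b' c' d' =
     mat2 (a * a' + b * c') (a * b' + b * d') (c * a' + d * c') (c * b' + d * (d' :: 'a :: semiring_0))"
  by (rule eq_matI) (auto simp: mat2_def scalar_prod_def less_2_cases_iff numeral_2_eq_2)

lemma one_mat_2_eq: "1\<^sub>m 2 = mat2 1 0 0 1"
  by (rule eq_matI) (auto simp: mat2_def less_2_cases_iff)

lemma det_mat2: "det (mat2 a b c d) = a * d - b * (c :: 'a :: comm_ring_1)"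
proof -
  have del: "mat_delete (mat2 a b c d) 0 0 = mat 1 1 (\<lambda>_. d)"
    "mat_delete (mat2 a b c d) 1 0 = mat 1 1 (\<lambda>_. b)"
    by (auto simp: mat_delete_def mat2_def intro!: eq_matI)
  have "det (mat2 a b c d) = (\<Sum>i<2. mat2 a b c d $$ (i, 0) * cofactor (mat2 a b c d) i 0)"
    by (rule laplace_expansion_column) auto
  also have "\<dots> = a * d - b * c"
    using del[unfolded One_nat_def]
    by (simp add: numeral_2_eq_2 cofactor_def det_single) (simp add: mat2_def mult.commute)
  finally show ?thesis .
qed

lemma carrier_SL_2:
  "carrier (SL 2) = {mat2 a b c d | a b c d :: 'a :: field. a * d - b * c = 1}"
  unfolding SL_def carrier_mat_2_eq by (auto simp: det_mat2)

text \<open>The right-hand side is the vanishing of the cross product of the vectors \<open>(a - d, b, c)\<close> and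
  \<open>(a' - d', b', c')\<close>, which are zero only for scalar matrices.\<close>

lemma mat2_commute_iff:
  "mat2 a b c d * mat2 a' b' c' d' = mat2 a' b' c' d' * mat2 a b c (d :: 'a :: field) \<longleftrightarrow>
     b * c' = b' * c \<and> (a - d) * b' = (a' - d') * b \<and> (a - d) * c' = (a' - d') * c"
  unfolding mat2_mult mat2_eq_iff by (auto simp: algebra_simps) 

text \<open>The matrices of determinant 1 of the form \<open>y (z I + N)\<close>, where \<open>N = mat2 t b c 0\<close>.\<close>

fun commuting_class :: "'a :: field \<times> 'a \<times> 'a \<Rightarrow> 'a mat set" where
  "commuting_class (t, b, c) =
     {mat2 (y * (z + t)) (y * b) (y * c) (y * z) | y z. y ^ 2 * (z * (z + t) - b * c) = 1}"

text \<open>Each point is represented by its homogeneous coordinates with first nonzero entry 1.\<close>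

definition proj_plane :: "('a :: field \<times> 'a \<times> 'a) set" where
  "proj_plane = {1} \<times> UNIV \<times> UNIV \<union> {0} \<times> ({1} \<times> UNIV \<union> {(0, 1)})"

section \<open>Partition of the nonidentity elements by points of the projective plane\<close>

lemma ex_proj_plane:
  assumes "t \<noteq> 0 \<or> b \<noteq> 0 \<or> c \<noteq> (0 :: 'a :: field)"
  shows "\<exists>y t' b' c'. (t', b', c') \<in> proj_plane \<and> y \<noteq> 0 \<and> t = y * t' \<and> b = y * b' \<and> c = y * c'"
proof -
  consider "t \<noteq> 0" | "t = 0" "b \<noteq> 0" | "t = 0" "b = 0" "c \<noteq> 0" using assms by auto
  then show ?thesis
  proof cases
    case 1
    then show ?thesis
      by (intro exI[of _ t] exI[of _ 1] exI[of _ "b / t"] exI[of _ "c / t"]) (auto simp: proj_plane_def)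
  next
    case 2
    then show ?thesis
      by (intro exI[of _ b] exI[of _ 0] exI[of _ 1] exI[of _ "c / b"]) (auto simp: proj_plane_def)
  next
    case 3
    then show ?thesis
      by (intro exI[of _ c] exI[of _ 0] exI[of _ 0] exI[of _ 1]) (auto simp: proj_plane_def)
  qed
qed

text \<open>A vanishing cross product makes the two nonzero vectors proportional, and the
  normalisation of the first nonzero entry leaves 1 as the only factor.\<close>

lemma proj_plane_eqI:
  assumes "(t, b, c) \<in> proj_plane" "(t', b', c') \<in> proj_plane"
    and "b * c' = b' * c" "t * b' = t' * b" "t * c' = t' * (c :: 'a :: field)"
  shows "t = t' \<and> b = b' \<and> c = c'"
  using assms by (auto simp: proj_plane_def)

lemma proj_plane_nonzero: "(t, b, c) \<in> proj_plane \<Longrightarrow> t \<noteq> 0 \<or> b \<noteq> 0 \<or> c \<noteq> (0 :: 'a :: field)"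
  by (auto simp: proj_plane_def)

lemma commuting_class_SL:
  assumes "N \<in> proj_plane" "A \<in> commuting_class N"
  shows "A \<in> carrier (SL 2)" "A \<noteq> 1\<^sub>m 2"
proof -
  obtain t b c where N: "N = (t, b, c)" by (cases N)
  obtain y z where A: "A = mat2 (y * (z + t)) (y * b) (y * c) (y * z)"
    and eq: "y ^ 2 * (z * (z + t) - b * c) = 1"
    using assms(2) N by auto
  have "y * (z + t) * (y * z) - y * b * (y * c) = 1"
    using eq by (simp add: algebra_simps power2_eq_square)
  then show "A \<in> carrier (SL 2)" unfolding carrier_SL_2 A by blast
  \<comment> \<open>The identity has the vector \<open>(0, 0, 0)\<close>, whereas that of
    \<open>A\<close> is the nonzero multiple \<open>y\<close> of \<open>(t, b, c)\<close>.\<close>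
  have "y \<noteq> 0" using eq by auto
  then show "A \<noteq> 1\<^sub>m 2"
    using proj_plane_nonzero[of t b c] assms(1) N unfolding A one_mat_2_eq
    by (auto simp: distrib_left)
qed

text \<open>The vectors of \<open>A\<close> and \<open>B\<close> are nonzero multiples of
  \<open>N\<close> and \<open>M\<close>, so the cross product criterion depends only on the two
  points.\<close>

lemma commuting_class_commute_iff:
  assumes "N \<in> proj_plane" "M \<in> proj_plane" "A \<in> commuting_class N" "B \<in> commuting_class M"
  shows "A * B = B * A \<longleftrightarrow> N = M"
proof -
  obtain t b c t' b' c' where NM: "N = (t, b, c)" "M = (t', b', c')"
    by (cases N, cases M) auto
  obtain y z where A: "A = mat2 (y * (z + t)) (y * b) (y * c) (y * z)"
    and eq: "y ^ 2 * (z * (z + t) - b * c) = 1"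
    using assms(3) NM by auto
  obtain y' z' where B: "B = mat2 (y' * (z' + t')) (y' * b') (y' * c') (y' * z')"
    and eq': "y' ^ 2 * (z' * (z' + t') - b' * c') = 1"
    using assms(4) NM by auto
  have y: "y \<noteq> 0" "y' \<noteq> 0" using eq eq' by auto
  have t: "y * (z + t) - y * z = y * t" "y' * (z' + t') - y' * z' = y' * t'"
    by (simp_all add: algebra_simps)
  \<comment> \<open>The order of the factors is that of the commutation criterion after
    substitution, so one rewrite rule cancels the scalars in all three equations.\<close>
  have canc: "y * u * (y' * v) = y' * v' * (y * u') \<longleftrightarrow> u * v = v' * u'" for u v u' v'
  proof -
    have "y * u * (y' * v) = (y * y') * (u * v)" "y' * v' * (y * u') = (y * y') * (v' * u')"
      by simp_all
    then show ?thesis using y by simp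
  qed
  have "A * B = B * A \<longleftrightarrow> b * c' = b' * c \<and> t * b' = t' * b \<and> t * c' = t' * c"
    unfolding A B mat2_commute_iff t canc ..
  also have "\<dots> \<longleftrightarrow> N = M"
    using proj_plane_eqI[of t b c t' b' c'] assms(1,2) NM by auto
  finally show ?thesis .
qed

lemma ex_commuting_class:
  assumes two: "(2 :: 'q :: {field, finite}) = 0"
    and A: "A \<in> carrier (SL 2)" "A \<noteq> 1\<^sub>m 2"
  shows "\<exists>N \<in> proj_plane. A \<in> commuting_class (N :: 'q \<times> 'q \<times> 'q)"
proof -
  obtain a b c d where A_eq: "A = mat2 a b c d" and det: "a * d - b * c = 1"
    using A(1) unfolding carrier_SL_2 by auto
  \<comment> \<open>Otherwise \<open>A\<close> is scalar with \<open>a ^ 2 = 1\<close>, and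
    uniqueness of square roots makes it the identity.\<close>
  have "a - d \<noteq> 0 \<or> b \<noteq> 0 \<or> c \<noteq> 0"
  proof (rule ccontr)
    assume "\<not> ?thesis"
    then have *: "d = a" "b = 0" "c = 0" by auto
    then have "a ^ 2 = 1 ^ 2" using det by (simp add: power2_eq_square)
    then have "a = 1" using power2_eq_iff_char_2[OF two] by metis
    then show False using A(2) * by (simp add: A_eq one_mat_2_eq)
  qed
  from ex_proj_plane[OF this] obtain y t' b' c' where
    N: "(t', b', c') \<in> proj_plane" "y \<noteq> 0" "a - d = y * t'" "b = y * b'" "c = y * c'" by blast
  have a: "a = d + y * t'" using N(3) by (simp add: algebra_simps)
  \<comment> \<open>The lower right entry \<open>y * z\<close> has to be \<open>d\<close>, which
    forces \<open>z = d / y\<close>; the left-hand side is then the determinant of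
    \<open>A\<close>.\<close>
  have "y ^ 2 * (d / y * (d / y + t') - b' * c') = 1"
    using det N(2) unfolding a N(4,5) by (simp add: field_simps power2_eq_square)
  moreover have "A = mat2 (y * (d / y + t')) (y * b') (y * c') (y * (d / y))"
    using N(2) by (simp add: A_eq a N(4,5) field_simps)
  ultimately have "A \<in> commuting_class (t', b', c')"
    unfolding commuting_class.simps by blast
  with N(1) show ?thesis by blast
qed

section \<open>Sizes of the classes and the number of split points\<close>

lemma card_commuting_class:
  assumes two: "(2 :: 'q :: {field, finite}) = 0"
    and N: "(t, b, c) \<in> proj_plane"
  shows "card (commuting_class (t, b, c)) = CARD('q) - card {z :: 'q. z * (z + t) = b * c}"
proof -
  define D where "D z = z * (z + t) - b * c" for z
  \<comment> \<open>For \<open>D z\<close> nonzero, \<open>s (D z)\<close> is the only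
    \<open>y\<close> that gives determinant 1.\<close>
  obtain s :: "'q \<Rightarrow> 'q" where s: "s u ^ 2 = inverse u" for u
    using ex_square_root[OF two, of "inverse _"] by metis
  define g where "g z = (let y = s (D z) in mat2 (y * (z + t)) (y * b) (y * c) (y * z))" for z
  have "commuting_class (t, b, c) = g ` {z. D z \<noteq> 0}"
  proof (intro equalityI subsetI)
    fix A assume "A \<in> commuting_class (t, b, c)"
    then obtain y z where A: "A = mat2 (y * (z + t)) (y * b) (y * c) (y * z)"
      and eq: "y ^ 2 * D z = 1" by (auto simp: D_def)
    then have "D z \<noteq> 0" by auto
    with eq have "y ^ 2 = s (D z) ^ 2" by (simp add: s field_simps)
    then have "y = s (D z)" by (simp add: power2_eq_iff_char_2[OF two])
    then have "A = g z" by (simp add: g_def A Let_def)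
    then show "A \<in> g ` {z. D z \<noteq> 0}" using \<open>D z \<noteq> 0\<close> by blast
  next
    fix A assume "A \<in> g ` {z. D z \<noteq> 0}"
    then obtain z where "D z \<noteq> 0" "A = g z" by auto
    moreover have "s (D z) ^ 2 * D z = 1" using \<open>D z \<noteq> 0\<close> by (simp add: s)
    ultimately show "A \<in> commuting_class (t, b, c)"
      unfolding g_def Let_def D_def by auto
  qed
  moreover have "inj_on g {z. D z \<noteq> 0}"
  proof (rule inj_onI)
    fix z w assume zw: "z \<in> {z. D z \<noteq> 0}" "w \<in> {z. D z \<noteq> 0}" "g z = g w"
    have nz: "s (D z) \<noteq> 0" using zw(1) s[of "D z"] by auto
    have eqs: "s (D z) * b = s (D w) * b" "s (D z) * c = s (D w) * c" "s (D z) * z = s (D w) * w"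
      "s (D z) * (z + t) = s (D w) * (w + t)"
      using zw(3) by (simp_all add: g_def Let_def)
    \<comment> \<open>Subtracting the diagonal entries isolates the multiple of \<open>t\<close>.
      One of \<open>t\<close>, \<open>b\<close>, \<open>c\<close> is nonzero, so the scalar can be
      recovered from the matrix, and then \<open>z\<close> from the lower right entry.\<close>
    then have "s (D z) * t = s (D w) * t" by (simp add: distrib_left)
    then have "s (D z) = s (D w)" using eqs proj_plane_nonzero[OF N] by auto
    then show "z = w" using eqs(3) nz by simp
  qed
  ultimately have "card (commuting_class (t, b, c)) = card {z. D z \<noteq> 0}"
    by (simp add: card_image)
  also have "{z. D z \<noteq> 0} = UNIV - {z. z * (z + t) = b * c}" by (auto simp: D_def)
  also have "card \<dots> = CARD('q) - card {z. z * (z + t) = b * c}"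
    by (rule card_Diff_subset) simp_all
  finally show ?thesis .
qed

text \<open>Squaring is bijective. The summand 0 keeps the shape of the general count at
  \<open>t = 0\<close>.\<close>

lemma card_roots_inseparable:
  assumes two: "(2 :: 'q :: {field, finite}) = 0"
  shows "card {z :: 'q. z * (z + 0) = u} = 1"
proof -
  obtain x :: 'q where "x ^ 2 = u" using ex_square_root[OF two] by blast
  then have "{z :: 'q. z * (z + 0) = u} = {x}"
    by (auto simp: power2_eq_iff_char_2[OF two] simp flip: power2_eq_square)
  then show ?thesis by simp
qed

text \<open>The two sides differ by \<open>(z - x) * (z + x + 1)\<close>, and signs do not matter in
  characteristic 2.\<close>

lemma artin_schreier_eq_iff:
  assumes two: "(2 :: 'q :: {field, finite}) = 0"
  shows "z * (z + 1) = x * (x + 1) \<longleftrightarrow> z = x \<or> z = x + (1 :: 'q)"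
proof -
  have "z * (z + 1) = x * (x + 1) \<longleftrightarrow> (z - x) * (z + x + 1) = 0" by (auto simp: algebra_simps)
  also have "z + x + 1 = z - (x + 1)" by (simp add: diff_eq_add_char_2[OF two] add.assoc)
  finally show ?thesis by simp
qed

lemma card_roots_separable:
  assumes two: "(2 :: 'q :: {field, finite}) = 0"
  shows "card {z :: 'q. z * (z + 1) = u} = (if \<exists>z :: 'q. z * (z + 1) = u then 2 else 0)"
proof (cases "\<exists>z :: 'q. z * (z + 1) = u")
  case True
  then obtain x where x: "x * (x + 1) = u" by blast
  have "{z :: 'q. z * (z + 1) = u} = {x, x + 1}"
    by (simp add: artin_schreier_eq_iff[OF two] set_eq_iff flip: x)
  then show ?thesis using True by simp
qed simp

lemma card_split_points:
  assumes two: "(2 :: 'q :: {field, finite}) = 0"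
  shows "2 * card {(b, c). \<exists>z :: 'q. z * (z + 1) = b * c} = CARD('q) * (CARD('q) + 1)"
proof -
  let ?T = "SIGMA p:UNIV :: ('q \<times> 'q) set. {z. z * (z + 1) = fst p * snd p}"
  let ?U = "(UNIV - {0 :: 'q}) \<times> (UNIV :: 'q set)" and ?V = "(UNIV :: 'q set) \<times> {0 :: 'q, 1}"
  \<comment> \<open>First count: the fibre over a pair has two elements if the polynomial splits and
    none otherwise.\<close>
  have "card ?T = (\<Sum>p\<in>UNIV. if \<exists>z :: 'q. z * (z + 1) = fst p * snd p then 2 else 0)"
    by (simp add: card_roots_separable[OF two])
  also have "\<dots> = 2 * card {p. \<exists>z :: 'q. z * (z + 1) = fst p * snd p}"
    by (simp add: sum.If_cases)
  finally have T: "card ?T = 2 * card {(b, c). \<exists>z :: 'q. z * (z + 1) = b * c}"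
    by (simp add: case_prod_unfold)
  \<comment> \<open>Second count, by \<open>c\<close>: if \<open>c\<close> is nonzero,
    \<open>z\<close> is free and determines \<open>b\<close>; if \<open>c = 0\<close>, then
    \<open>z\<close> is 0 or 1 and \<open>b\<close> is free. With \<open>q\<close> elements in the
    field this gives \<open>(q - 1) * q + 2 * q\<close>.\<close>
  let ?f = "\<lambda>(c, z). ((z * (z + 1) / c, c), z :: 'q)" and ?g = "\<lambda>(b, z). ((b, 0 :: 'q), z :: 'q)"
  have "?T = ?f ` ?U \<union> ?g ` ?V"
  proof (intro equalityI subsetI)
    fix p assume "p \<in> ?T"
    then obtain b c z where p: "p = ((b, c), z)" "z * (z + 1) = b * c" by auto
    show "p \<in> ?f ` ?U \<union> ?g ` ?V"
    proof (cases "c = 0")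
      case True
      then have "z = 0 \<or> z = 1" using artin_schreier_eq_iff[OF two, of z 0] p(2) by simp
      then have "(b, z) \<in> ?V" by auto
      then show ?thesis using True p(1) by force
    next
      case False
      then have "(c, z) \<in> ?U" "p = ?f (c, z)" using p by (auto simp: field_simps)
      then show ?thesis by blast
    qed
  next
    fix p assume "p \<in> ?f ` ?U \<union> ?g ` ?V"
    then show "p \<in> ?T" using two by auto
  qed
  moreover have "?f ` ?U \<inter> ?g ` ?V = {}" by auto
  ultimately have "card ?T = card (?f ` ?U) + card (?g ` ?V)"
    by (simp add: card_Un_disjoint)
  also have "card (?f ` ?U) = card ?U" by (rule card_image) (auto simp: inj_on_def)
  also have "card (?g ` ?V) = card ?V" by (rule card_image) (auto simp: inj_on_def)
  also have "card ?U + card ?V = CARD('q) * (CARD('q) + 1)"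
    by (cases "CARD('q)") (simp_all add: card_cartesian_product card_Diff_singleton)
  finally show ?thesis using T by simp
qed

section \<open>The trivial centre and the passage to the quotient\<close>

lemma group_center_SL_2:
  assumes two: "(2 :: 'q :: {field, finite}) = 0"
  shows "group_center (SL 2) = {1\<^sub>m 2 :: 'q mat}"
proof (intro equalityI subsetI)
  fix A :: "'q mat" assume A: "A \<in> group_center (SL 2)"
  then obtain a b c d where A_eq: "A = mat2 a b c d" and det: "a * d - b * c = 1"
    unfolding group_center_def carrier_SL_2 by auto
  have "A * B = B * A" if "B \<in> carrier (SL 2)" for B
    using A that by (simp add: group_center_def SL_def)
  \<comment> \<open>Two transvections suffice as tests: the upper one forces \<open>c = 0\<close>
    and \<open>a = d\<close>, the lower one \<open>b = 0\<close>.\<close>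
  moreover have "mat2 1 1 0 1 \<in> carrier (SL 2)" "mat2 1 0 1 1 \<in> carrier (SL 2)"
    unfolding carrier_SL_2 by auto
  ultimately have "A * mat2 1 1 0 1 = mat2 1 1 0 1 * A" "A * mat2 1 0 1 1 = mat2 1 0 1 1 * A"
    by blast+
  then have *: "b = 0" "c = 0" "a = d" unfolding A_eq mat2_commute_iff by auto
  then have "a ^ 2 = 1 ^ 2" using det by (simp add: power2_eq_square)
  then have "a = 1" using power2_eq_iff_char_2[OF two] by metis
  then show "A \<in> {1\<^sub>m 2}" using * by (simp add: A_eq one_mat_2_eq)
next
  fix A :: "'q mat" assume "A \<in> {1\<^sub>m 2}"
  then show "A \<in> group_center (SL 2)"
    by (auto simp: group_center_def SL_def)
qed

text \<open>The cosets of the trivial centre are singletons, so \<open>A\<close> and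
  \<open>{A}\<close> can be identified.\<close>

lemma carrier_PSL_2:
  assumes two: "(2 :: 'q :: {field, finite}) = 0"
  shows "carrier (PSL 2 :: 'q mat set monoid) = (\<lambda>A. {A}) ` carrier (SL 2)"
  unfolding PSL_def FactGroup_def RCOSETS_def r_coset_def group_center_SL_2[OF two]
  by (auto simp: SL_def)

lemma mult_PSL: "{A} \<otimes>\<^bsub>PSL n\<^esub> {B} = {A * B}"
  by (simp add: PSL_def FactGroup_def set_mult_def SL_def)

lemma group_center_PSL_2:
  assumes two: "(2 :: 'q :: {field, finite}) = 0"
  shows "group_center (PSL 2 :: 'q mat set monoid) = {{1\<^sub>m 2}}"
proof -
  have "group_center (PSL 2 :: 'q mat set monoid) = (\<lambda>A. {A}) ` group_center (SL 2)"
    unfolding group_center_def carrier_PSL_2[OF two] by (auto simp: mult_PSL) (auto simp: SL_def)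
  then show ?thesis by (simp add: group_center_SL_2[OF two])
qed


subsection \<open>The commuting graph of \<open>PSL(2,q)\<close>\<close>

lemma sum_constant_mset: "(\<Sum>x\<in>A. M) = repeat_mset (card A) M"
  by (induction A rule: infinite_finite_induct) auto

lemma card_commuting_class_inseparable:
  assumes two: "(2 :: 'q :: {field, finite}) = 0" and "(0, b, c) \<in> proj_plane"
  shows "card (commuting_class (0 :: 'q, b, c)) = CARD('q) - 1"
  using card_commuting_class[OF assms] card_roots_inseparable[OF two] by simp

lemma card_commuting_class_separable:
  assumes two: "(2 :: 'q :: {field, finite}) = 0"
  shows "card (commuting_class (1 :: 'q, b, c)) =
    (if \<exists>z :: 'q. z * (z + 1) = b * c then CARD('q) - 2 else CARD('q))"
  using card_commuting_class[OF two, of 1 b c] card_roots_separable[OF two, of "b * c"]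
  by (simp add: proj_plane_def)

text \<open>Groups the points by class size: the line \<open>t = 0\<close>, the \<open>s\<close>
  split points with \<open>t = 1\<close>, and the other points with \<open>t = 1\<close>. In the
  application \<open>f n\<close> is the spectrum of a clique with \<open>n\<close> vertices.\<close>

lemma sum_proj_plane_commuting_class:
  fixes f :: "nat \<Rightarrow> 'b multiset"
  assumes two: "(2 :: 'q :: {field, finite}) = 0"
  defines "s \<equiv> card {(b, c). \<exists>z :: 'q. z * (z + 1) = b * c}"
  shows "(\<Sum>N \<in> (proj_plane :: ('q \<times> 'q \<times> 'q) set). f (card (commuting_class N))) =
    repeat_mset (CARD('q) + 1) (f (CARD('q) - 1)) + repeat_mset s (f (CARD('q) - 2)) +
    repeat_mset (CARD('q) ^ 2 - s) (f CARD('q))"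
proof -
  let ?A = "{1 :: 'q} \<times> UNIV :: ('q \<times> 'q \<times> 'q) set"
    and ?B = "{0 :: 'q} \<times> ({1} \<times> UNIV \<union> {(0, 1)}) :: ('q \<times> 'q \<times> 'q) set"
    and ?S = "{(b, c). \<exists>z :: 'q. z * (z + 1) = b * c}"
  have AB: "proj_plane = ?A \<union> ?B" "?A \<inter> ?B = {}" by (auto simp: proj_plane_def)
  have A_eq: "?A = Pair 1 ` ?S \<union> Pair 1 ` (- ?S)" by auto
  have "(\<Sum>N\<in>?A. f (card (commuting_class N))) =
      (\<Sum>N\<in>Pair 1 ` ?S. f (card (commuting_class N))) + (\<Sum>N\<in>Pair 1 ` (- ?S). f (card (commuting_class N)))"
    unfolding A_eq by (rule sum.union_disjoint) auto
  also have "(\<Sum>N\<in>Pair 1 ` ?S. f (card (commuting_class N))) = (\<Sum>N\<in>Pair (1 :: 'q) ` ?S. f (CARD('q) - 2))"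
    by (rule sum.cong) (auto simp: card_commuting_class_separable[OF two] simp del: commuting_class.simps)
  also have "\<dots> = repeat_mset s (f (CARD('q) - 2))"
    by (simp add: sum_constant_mset s_def card_image inj_on_def)
  also have "(\<Sum>N\<in>Pair 1 ` (- ?S). f (card (commuting_class N))) = (\<Sum>N\<in>Pair (1 :: 'q) ` (- ?S). f CARD('q))"
    by (rule sum.cong) (auto simp: card_commuting_class_separable[OF two] simp del: commuting_class.simps split: if_splits)
  also have "\<dots> = repeat_mset (CARD('q) ^ 2 - s) (f CARD('q))"
    by (simp add: sum_constant_mset s_def card_image inj_on_def Compl_eq_Diff_UNIV card_Diff_subset
        power2_eq_square)
  finally have A: "(\<Sum>N\<in>?A. f (card (commuting_class N))) =
      repeat_mset s (f (CARD('q) - 2)) + repeat_mset (CARD('q) ^ 2 - s) (f CARD('q))" .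
  have "(\<Sum>N\<in>?B. f (card (commuting_class N))) = (\<Sum>N\<in>?B. f (CARD('q) - 1))"
    by (rule sum.cong)
      (auto simp: card_commuting_class_inseparable[OF two] proj_plane_def simp del: commuting_class.simps)
  \<comment> \<open>The line \<open>t = 0\<close> consists of the points \<open>(0, 1, c)\<close>
    and of \<open>(0, 0, 1)\<close>.\<close>
  also have "card ?B = CARD('q) + 1"
    unfolding card_cartesian_product by (subst card_Un_disjoint) (auto simp: card_cartesian_product)
  then have "(\<Sum>N\<in>?B. f (CARD('q) - 1)) = repeat_mset (CARD('q) + 1) (f (CARD('q) - 1))"
    by (simp only: sum_constant_mset)
  finally show ?thesis
    unfolding AB(1) by (subst sum.union_disjoint[OF _ _ AB(2)]) (simp_all only: finite A ac_simps)
qed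

lemma graph_spectrum_PSL_2_char_2:
  assumes two: "(2 :: 'q :: {field, finite}) = 0" and card: "CARD('q) > 2"
  shows "graph_spectrum (commuting_graph (PSL 2 :: 'q mat set monoid)) =
    (\<Sum>N \<in> (proj_plane :: ('q \<times> 'q \<times> 'q) set).
       add_mset (of_nat (card (commuting_class N) - 1))
         (replicate_mset (card (commuting_class N) - 1) (- 1)))"
proof -
  let ?s = "\<lambda>A :: 'q mat. {A}" and ?P = "proj_plane :: ('q \<times> 'q \<times> 'q) set"
  let ?C = "\<lambda>N. ?s ` commuting_class N"
  let ?G = "commuting_graph (PSL 2 :: 'q mat set monoid)"
  have pverts: "pverts ?G = ?s ` (carrier (SL 2) - {1\<^sub>m 2})"
    by (auto simp: commuting_graph_def carrier_PSL_2[OF two] group_center_PSL_2[OF two])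
  have classes: "carrier (SL 2) - {1\<^sub>m 2} = (\<Union>N\<in>?P. commuting_class N)"
    using ex_commuting_class[OF two] commuting_class_SL by blast
  have arcs: "({A}, {B}) \<in> parcs ?G \<longleftrightarrow> N = M \<and> {A} \<noteq> {B}"
    if "N \<in> ?P" "M \<in> ?P" "A \<in> commuting_class N" "B \<in> commuting_class M" for N M A B
  proof -
    have "{A} \<in> pverts ?G" "{B} \<in> pverts ?G" unfolding pverts classes using that by auto
    then have "({A}, {B}) \<in> parcs ?G \<longleftrightarrow> {A} \<noteq> {B} \<and> {A * B} = {B * A}"
      by (auto simp: commuting_graph_def mult_PSL)
    then show ?thesis using commuting_class_commute_iff[OF that] by auto
  qed
  have card_s: "card (?C N) = card (commuting_class N)" for N
    by (rule card_image) (simp add: inj_on_def)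
  \<comment> \<open>The smallest possible size is \<open>CARD('q) - 2\<close>, positive by
    \<open>card\<close>; over the field with two elements the split classes would be empty.\<close>
  have pos: "card (commuting_class N) > 0" if "N \<in> ?P" for N
  proof -
    obtain t b c where N: "N = (t, b, c)" by (cases N)
    then have "t = 0 \<or> t = 1" using that by (auto simp: proj_plane_def)
    then show ?thesis
      using that card N card_commuting_class_inseparable[OF two, of b c]
        card_commuting_class_separable[OF two, of b c]
      by (auto simp del: commuting_class.simps)
  qed
  \<comment> \<open>A common element of two classes commutes with itself, so their points
    agree.\<close>
  have "disjoint_family_on ?C ?P"
    unfolding disjoint_family_on_def using commuting_class_commute_iff by blast
  moreover have "finite (?C N) \<and> ?C N \<noteq> {}" if "N \<in> ?P" for N
    using pos[OF that] card_gt_0_iff by blast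
  moreover have "(x, y) \<in> parcs ?G \<longleftrightarrow> N = M \<and> x \<noteq> y"
    if "N \<in> ?P" "M \<in> ?P" "x \<in> ?C N" "y \<in> ?C M" for N M x y
    using arcs[OF that(1,2)] that(3,4) by blast
  moreover have "pverts ?G = (\<Union>N\<in>?P. ?C N)" unfolding pverts classes by blast
  ultimately show ?thesis
    by (subst graph_spectrum_disjoint_cliques[of ?P ?C]) (simp_all only: finite card_s simp_thms)
qed

theorem proposition2p5:
  fixes k :: nat
  assumes "k \<ge> 2"
    and "CARD('q :: {field, finite}) = 2 ^ k"
  shows "graph_spectrum (commuting_graph (PSL 2 :: 'q mat set monoid)) =
      replicate_mset (2 ^ (3 * k) - 2 ^ (2 * k) - 2 ^ (k + 1) - 2) (- 1)
    + replicate_mset (2 ^ (k - 1) * (2 ^ k - 1)) (2 ^ k - 1)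
    + replicate_mset (2 ^ k + 1) (2 ^ k - 2)
    + replicate_mset (2 ^ (k - 1) * (2 ^ k + 1)) (2 ^ k - 3)"
proof -
  have two: "(2 :: 'q) = 0" by (rule two_eq_0_of_card_power_2[OF assms(2)])
  \<comment> \<open>Half the field size; all multiplicities become polynomials in
    \<open>p\<close>.\<close>
  define p :: nat where "p = 2 ^ (k - 1)"
  have k: "2 ^ k = 2 * p" using assms(1) by (cases k) (simp_all add: p_def)
  have "2 ^ 1 \<le> p" unfolding p_def using assms(1) by (intro power_increasing) auto
  \<comment> \<open>Substituting \<open>r + 2\<close> for \<open>p\<close> turns the truncated
    subtractions on naturals into exact ones.\<close>
  then obtain r where r: "p = r + 2" using le_Suc_ex by (metis add.commute power_one_right)
  have card: "CARD('q) = 2 * p" using assms(2) k by simp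
  define s where "s = card {(b, c). \<exists>z :: 'q. z * (z + 1) = b * c}"
  have s: "s = p * (2 * p + 1)"
    using card_split_points[OF two] unfolding card s_def[symmetric] by simp
  have s': "(2 * p) ^ 2 - p * (2 * p + 1) = p * (2 * p - 1)"
    by (simp add: r power2_eq_square algebra_simps)
  define f :: "nat \<Rightarrow> complex multiset" where
    "f n = add_mset (of_nat (n - 1)) (replicate_mset (n - 1) (- 1))" for n
  have f: "repeat_mset m (f n) = replicate_mset m (of_nat (n - 1)) + replicate_mset (m * (n - 1)) (- 1)" for m n
    by (rule multiset_eqI) (simp add: f_def)
  have add: "replicate_mset (m + n) x = replicate_mset m x + replicate_mset n x"
    for m n and x :: complex
    by (rule multiset_eqI) simp
  have diffs: "2 * p - 1 - 1 = 2 * p - 2" "2 * p - 2 - 1 = 2 * p - 3" by simp_all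
  have "graph_spectrum (commuting_graph (PSL 2 :: 'q mat set monoid)) =
      (\<Sum>N \<in> (proj_plane :: ('q \<times> 'q \<times> 'q) set). f (card (commuting_class N)))"
    unfolding f_def using card r by (intro graph_spectrum_PSL_2_char_2[OF two]) simp
  also have "\<dots> = repeat_mset (2 * p + 1) (f (2 * p - 1)) + repeat_mset (p * (2 * p + 1)) (f (2 * p - 2)) +
    repeat_mset (p * (2 * p - 1)) (f (2 * p))"
    using sum_proj_plane_commuting_class[OF two, of f] unfolding card s_def[symmetric] s s' .
  also have "\<dots> = replicate_mset ((2 * p + 1) * (2 * p - 2) + p * (2 * p + 1) * (2 * p - 3) + p * (2 * p - 1) * (2 * p - 1)) (- 1)
    + replicate_mset (p * (2 * p - 1)) (of_nat (2 * p - 1))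
    + replicate_mset (2 * p + 1) (of_nat (2 * p - 2))
    + replicate_mset (p * (2 * p + 1)) (of_nat (2 * p - 3))"
    unfolding f add diffs by (simp only: ac_simps)
  \<comment> \<open>With \<open>q = 2 * p\<close> this multiplicity is the number of vertices,
    \<open>q ^ 3 - q - 1\<close>, minus the number of cliques, \<open>q ^ 2 + q + 1\<close>.\<close>
  also have "(2 * p + 1) * (2 * p - 2) + p * (2 * p + 1) * (2 * p - 3) + p * (2 * p - 1) * (2 * p - 1) =
    2 ^ (3 * k) - 2 ^ (2 * k) - 2 ^ (k + 1) - 2"
  proof -
    have "2 ^ (3 * k) = (2 * p) ^ 3" "2 ^ (2 * k) = (2 * p) ^ 2" "2 ^ (k + 1) = 4 * p"
      by (simp_all add: mult.commute[of _ k] power_mult k)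
    then show ?thesis
      by (simp add: r power2_eq_square power3_eq_cube algebra_simps)
  qed
  finally have "graph_spectrum (commuting_graph (PSL 2 :: 'q mat set monoid)) =
      replicate_mset (2 ^ (3 * k) - 2 ^ (2 * k) - 2 ^ (k + 1) - 2) (- 1)
    + replicate_mset (p * (2 * p - 1)) (of_nat (2 * p - 1))
    + replicate_mset (2 * p + 1) (of_nat (2 * p - 2))
    + replicate_mset (p * (2 * p + 1)) (of_nat (2 * p - 3))" .
  moreover have "of_nat (2 * p - 1) = (2 ^ k - 1 :: complex)"
    "of_nat (2 * p - 2) = (2 ^ k - 2 :: complex)" "of_nat (2 * p - 3) = (2 ^ k - 3 :: complex)"
    using arg_cong[OF k, of "of_nat :: nat \<Rightarrow> complex"] r by (simp_all add: of_nat_diff)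
  ultimately show ?thesis by (simp only: k p_def[symmetric])
qed

end
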